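(* Each of the following functions is a stable pair potential, but not a sum of a positive function and a real valued positive definite function (on the respective group $\mathbb{Z}$ or $\mathbb{R}$). (1) The function $V:\mathbb{Z}\to\mathbb{R}$ defined by $$V(0)=V(2)=V(-2)=1,\qquad V(1)=V(-1)=-1,\qquad V(n)=0\ \text{ for all } n \text{ with } |n|\ge 3 .$$ (2) The function $W:\mathbb{R}\to\mathbb{R}$ defined by $$W(x)=\sum_{n\in\mathbb{Z}}\int_{-\infty}^{\infty}V(n)\,f(n-x+y)\,f(y)\,dy ,$$ with $f$ a positive continuous function $(-\tfrac12,\tfrac12)\to\mathbb{R}$ (taken to be $0$ outside $(-\tfrac12,\tfrac12)$) and $V$ the function of part (1).
   Context: "Positive" means nowhere negative (i.e. $\ge 0$ everywhere). Only pair potentials which are bounded continuous functions are considered. Stability: a bounded continuous function $W:\mathbb{R}\to\mathbb{R}$ is stable if $\iint W(x-y)\,d\rho(x)\,d\rho(y)\ge 0$ for every positive finite measure $\rho$ on $\mathbb{R}$. A bounded function $V:\mathbb{Z}\to\mathbb{R}$ is stable if $\sum_{m\in\mathbb{Z}}\sum_{n\in\mathbb{Z}}\rho(m)V(m-n)\rho(n)\ge 0$ for every positive summable function $\rho$ on $\mathbb{Z}$ (i.e. every finite positive measure on $\mathbb{Z}$). Positive definiteness: a function $g$ on an abelian group $G$ is positive definite (of positive type) if $\sum_{i,j=1}^{N}c_i\overline{c_j}\,g(x_i-x_j)\ge 0$ for all $N$, all $x_1,\dots,x_N\in G$ and all $c_1,\dots,c_N\in\mathbb{C}$.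
   Formalization: In part (2), f is additionally assumed not identically zero (for f = 0, W = 0 is trivially such a sum) and square integrable (otherwise W(0) is infinite and W is not a real-valued function). *)

theory Defs
  imports "HOL-Analysis.Analysis"
begin

text \<open>Throughout, ``positive'' means nonnegative everywhere.\<close>

definition stable_int :: "(int \<Rightarrow> real) \<Rightarrow> bool" where
  "stable_int V \<longleftrightarrow>
     bounded (range V) \<and>
     (\<forall>\<rho> :: int \<Rightarrow> real. (\<forall>n. 0 \<le> \<rho> n) \<and> \<rho> summable_on UNIV \<longrightarrow>
        0 \<le> (\<Sum>\<^sub>\<infinity>m. \<Sum>\<^sub>\<infinity>n. \<rho> m * V (m - n) * \<rho> n))"

definition stable_real :: "(real \<Rightarrow> real) \<Rightarrow> bool" where
  "stable_real W \<longleftrightarrow>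
     continuous_on UNIV W \<and> bounded (range W) \<and>
     (\<forall>\<rho> :: real measure. finite_measure \<rho> \<and> sets \<rho> = sets borel \<longrightarrow>
        0 \<le> (LINT x|\<rho>. LINT y|\<rho>. W (x - y)))"

text \<open>No continuity or measurability is required of a positive definite function.\<close>

definition positive_definite :: "('a::ab_group_add \<Rightarrow> complex) \<Rightarrow> bool" where
  "positive_definite g \<longleftrightarrow>
     (\<forall>(N::nat) (x :: nat \<Rightarrow> 'a) (c :: nat \<Rightarrow> complex).
        (\<Sum>i<N. \<Sum>j<N. c i * cnj (c j) * g (x i - x j)) \<in> \<real>\<^sub>\<ge>\<^sub>0)"

definition sum_pos_posdef :: "('a::ab_group_add \<Rightarrow> real) \<Rightarrow> bool" where
  "sum_pos_posdef U \<longleftrightarrow>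
     (\<exists>P Q :: 'a \<Rightarrow> real.
        (\<forall>x. 0 \<le> P x) \<and> positive_definite (\<lambda>x. complex_of_real (Q x)) \<and>
        (\<forall>x. U x = P x + Q x))"

definition V_pot :: "int \<Rightarrow> real" where
  "V_pot n = (if n \<in> {0, 2, -2} then 1 else if n \<in> {1, -1} then -1 else 0)"

definition W_pot :: "(real \<Rightarrow> real) \<Rightarrow> real \<Rightarrow> real" where
  "W_pot f x = (\<Sum>\<^sub>\<infinity>n::int. LINT y|lborel. V_pot n * f (of_int n - x + y) * f y)"

text \<open>
  An admissible profile, extended by zero to the real line.  Not being identically zero is
  needed because otherwise the potential vanishes.  For a continuous nonnegative function on
  the open interval, which may blow up at the endpoints, square integrability says exactly that
  all integrals defining \<^const>\<open>W_pot\<close> are finite (the value at 0 contains the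
  integral of the square; the rest follows from Cauchy--Schwarz).
\<close>

definition admissible_profile :: "(real \<Rightarrow> real) \<Rightarrow> bool" where
  "admissible_profile f \<longleftrightarrow>
     continuous_on {-1/2<..<1/2} f \<and>
     (\<forall>x. 0 \<le> f x) \<and>
     (\<forall>x. x \<notin> {-1/2<..<1/2} \<longrightarrow> f x = 0) \<and>
     (\<exists>x. f x \<noteq> 0) \<and>
     integrable lborel (\<lambda>y. (f y)\<^sup>2)"

end

(*
The quadratic form of V on finitely many nonnegative weights is reduced at a site k carrying the
largest weight: the sites k - 1, k, k + 1 contribute a perfect square, and their interaction with
every other site is nonnegative because k outweighs its neighbours. Summing this inequality over
all translates of a window of length N expresses it through correlations, and N \<rightarrow> \<infinity> gives
stability on the integers and, with correlations of the measure smeared by f, on the reals.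

If V = P + Q, then Q 0 \<le> 1 and Q 1 \<le> -1 force Q 0 + Q 1 = 0, so Q is antiperiodic and Q 4 = 1,
which exceeds V 4 = 0. The restriction of W to the integers is a positive multiple of V.
*)

theory Submission
  imports Defs
begin

section \<open>Copositivity of \<open>V_pot\<close> on finite sets of sites\<close>

lemma V_pot_eq_0: "n \<notin> {-2..2} \<Longrightarrow> V_pot n = 0"
  by (auto simp: V_pot_def)

lemma V_pot_uminus: "V_pot (- n) = V_pot n"
  by (auto simp: V_pot_def)

lemma V_pot_copositive:
  fixes a :: "int \<Rightarrow> real"
  assumes "finite S" "\<And>i. 0 \<le> a i"
  shows "0 \<le> (\<Sum>i\<in>S. \<Sum>j\<in>S. V_pot (i - j) * a i * a j)"
  using assms(1)
proof (induction S rule: finite_psubset_induct)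
  case (psubset S)
  show ?case
  proof (cases "S = {}")
    case False
    define E where "E i j = V_pot (i - j) * a i * a j" for i j
    \<comment> \<open>Extending the weights by 0 off \<open>S\<close> avoids case distinctions on
      whether the neighbours of \<open>k\<close> belong to \<open>S\<close>.\<close>
    define b where "b i = (if i \<in> S then a i else 0)" for i
    have "Max (a ` S) \<in> a ` S" using False psubset.hyps by simp
    then obtain k where k: "k \<in> S" "a k = Max (a ` S)" by auto
    have b0: "0 \<le> b i" for i using assms(2) by (simp add: b_def)
    have bk: "b i \<le> b k" for i
      using k(1) Max_ge[of "a ` S" "a i"] psubset.hyps assms(2)[of k]
      by (auto simp: b_def simp flip: k(2))
    define K where "K = {k - 1, k, k + 1}"
    define T where "T = S \<inter> K"
    define R where "R = S - K"
    have fin: "finite T" "finite R" and RT: "R \<inter> T = {}" "S = R \<union> T"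
      using psubset.hyps by (auto simp: T_def R_def K_def)
    have TK: "sum h T = (\<Sum>i\<in>K. if i \<in> S then h i else 0)" for h :: "int \<Rightarrow> real"
      unfolding T_def by (subst Int_commute, rule sum.inter_restrict) (simp add: K_def)
    have "R \<subset> S" using k by (auto simp: R_def K_def)
    then have "0 \<le> (\<Sum>i\<in>R. \<Sum>j\<in>R. E i j)"
      unfolding E_def by (rule psubset.IH)
    \<comment> \<open>On three consecutive sites the matrix of \<open>V_pot\<close> has rank one: it
      is the outer square of the sign vector (1, -1, 1).\<close>
    moreover have "(\<Sum>i\<in>T. \<Sum>j\<in>T. E i j) = (b (k - 1) - b k + b (k + 1))\<^sup>2"
    proof -
      have "(\<Sum>i\<in>T. \<Sum>j\<in>T. E i j) = (\<Sum>i\<in>K. \<Sum>j\<in>K. V_pot (i - j) * b i * b j)"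
        unfolding TK by (auto simp: E_def b_def intro!: sum.cong)
      also have "\<dots> = (b (k - 1) - b k + b (k + 1))\<^sup>2"
        by (simp add: K_def V_pot_def power2_eq_square algebra_simps)
      finally show ?thesis .
    qed
    moreover have "0 \<le> (\<Sum>i\<in>T. E i j)" if "j \<in> R" for j
    proof -
      have j: "j \<noteq> k - 1" "j \<noteq> k" "j \<noteq> k + 1" using that by (auto simp: R_def K_def)
      have "(\<Sum>i\<in>T. E i j) = (\<Sum>i\<in>K. V_pot (i - j) * b i * a j)"
        unfolding TK by (intro sum.cong) (auto simp: E_def b_def)
      also have "\<dots> = (\<Sum>i\<in>K. V_pot (i - j) * b i) * a j"
        by (simp add: sum_distrib_right)
      also have "\<dots> \<ge> 0"
      proof (intro mult_nonneg_nonneg assms(2))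
        \<comment> \<open>At distance 2 from \<open>k\<close> the sum is \<open>b k\<close> minus
          the weight of the neighbour nearer to \<open>j\<close>, at distance 3 it is that
          neighbour's weight alone, and farther away every term vanishes.\<close>
        consider "j = k - 2" | "j = k - 3" | "j = k + 2" | "j = k + 3" | "4 \<le> \<bar>j - k\<bar>"
          using j by linarith
        then show "0 \<le> (\<Sum>i\<in>K. V_pot (i - j) * b i)"
        proof cases
          case 5
          then have "V_pot (i - j) = 0" if "i \<in> K" for i
            using that by (intro V_pot_eq_0) (auto simp: K_def)
          then show ?thesis by simp
        qed (use b0[of "k-1"] b0[of "k+1"] bk[of "k-1"] bk[of "k+1"] in \<open>simp_all add: K_def V_pot_def\<close>)
      qed
      finally show ?thesis .
    qed
    then have "0 \<le> (\<Sum>j\<in>R. \<Sum>i\<in>T. E i j)" by (rule sum_nonneg)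
    moreover have "(\<Sum>i\<in>T. \<Sum>j\<in>R. E i j) = (\<Sum>j\<in>R. \<Sum>i\<in>T. E i j)" by (rule sum.swap)
    moreover have "(\<Sum>i\<in>R. \<Sum>j\<in>T. E i j) = (\<Sum>j\<in>R. \<Sum>i\<in>T. E i j)"
      using V_pot_uminus[of "x - y" for x y] by (simp add: E_def mult.commute mult.left_commute)
    ultimately show ?thesis
      unfolding E_def[symmetric] using RT fin
      by (simp add: sum.union_disjoint sum.distrib)
  qed simp
qed

text \<open>Once a window has at least two sites, lengthening it by one adds exactly the sum of
  \<open>\<phi>\<close> over \<open>{-2..2}\<close>. The window sums thus grow linearly with that
  sum as slope, and a negative slope would eventually make them negative. Both stability proofs use
  this with \<open>\<phi>\<close> equal to \<open>V_pot\<close> times a correlation.\<close>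

lemma sum_nonneg_of_windows_nonneg:
  fixes \<phi> :: "int \<Rightarrow> real"
  assumes supp: "\<And>n. n \<notin> {-2..2} \<Longrightarrow> \<phi> n = 0"
    and windows: "\<And>N. 0 \<le> (\<Sum>i<N. \<Sum>j<N. \<phi> (int i - int j))"
  shows "0 \<le> (\<Sum>n\<in>{-2..2}. \<phi> n)"
proof (rule ccontr)
  define s where "s = (\<Sum>n\<in>{-2..2}. \<phi> n)"
  define T where "T N = (\<Sum>i<N. \<Sum>j<N. \<phi> (int i - int j))" for N :: nat
  have s: "s = \<phi> (-2) + \<phi> (-1) + \<phi> 0 + \<phi> 1 + \<phi> 2"
  proof -
    have "{-2..2::int} = {-2,-1,0,1,2}" by auto
    then show ?thesis by (simp add: s_def)
  qed
  \<comment> \<open>The length \<open>M + 2\<close> ensures that the sites at distance 1 and 2 from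
    the new one are both in the window.\<close>
  have step: "T (Suc (M + 2)) = T (M + 2) + s" for M
  proof -
    have "(\<Sum>j<M+2. \<phi> (int (M+2) - int j)) = \<phi> 1 + \<phi> 2"
      "(\<Sum>j<M+2. \<phi> (int j - int (M+2))) = \<phi> (-1) + \<phi> (-2)"
      by (auto simp: numeral_2_eq_2 intro!: sum.neutral supp)
    then show ?thesis
      by (simp only: T_def s sum.lessThan_Suc sum.distrib) simp
  qed
  have T: "T (M + 2) = T 2 + real M * s" for M
    by (induction M) (use step in \<open>auto simp: algebra_simps numeral_2_eq_2\<close>)
  assume "\<not> 0 \<le> (\<Sum>n\<in>{-2..2}. \<phi> n)"
  then have "s < 0" by (simp add: s_def)
  then obtain M where "T 2 < real M * (- s)" using reals_Archimedean3[of "- s"] by auto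
  then have "T (M + 2) < 0" by (subst T) simp
  with windows[of "M + 2"] show False by (simp add: T_def)
qed

lemma V_pot_copositive_window:
  fixes a :: "int \<Rightarrow> real"
  assumes "\<And>i. 0 \<le> a i"
  shows "0 \<le> (\<Sum>i<N. \<Sum>j<N. V_pot (int i - int j) * a (int i) * a (int j))"
  using V_pot_copositive[of "int ` {..<N}" a] assms by (simp add: sum.reindex)

section \<open>Positive definite functions and the failure of the decomposition on the
  integers\<close>

lemma positive_definiteD:
  "positive_definite g \<Longrightarrow> (\<Sum>i<(N::nat). \<Sum>j<N. c i * cnj (c j) * g (x i - x j)) \<in> \<real>\<^sub>\<ge>\<^sub>0"
  unfolding positive_definite_def by simp

lemma positive_definite_of_real:
  fixes Q :: "'a::ab_group_add \<Rightarrow> real"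
  assumes "positive_definite (\<lambda>x. complex_of_real (Q x))"
  shows "0 \<le> (\<Sum>i<(N::nat). \<Sum>j<N. c i * c j * Q (x i - x j))"
  using positive_definiteD[OF assms, of "\<lambda>i. complex_of_real (c i)" x N]
  by (simp flip: of_real_mult of_real_sum)

text \<open>With coefficients 1 and i at the points \<open>x\<close> and 0, the imaginary part of
  the form is \<open>Q (- x) - Q x\<close>. Complex coefficients are essential, since real ones only
  see the even part of \<open>Q\<close>.\<close>

lemma positive_definite_even:
  fixes Q :: "'a::ab_group_add \<Rightarrow> real"
  assumes "positive_definite (\<lambda>x. complex_of_real (Q x))"
  shows "Q (- x) = Q x"
  using positive_definiteD[OF assms, where N = 2 and c = "\<lambda>i. if i = 0 then 1 else \<i>"
      and x = "\<lambda>i. if i = 0 then x else 0"]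
  by (simp add: numeral_2_eq_2 complex_nonneg_Reals_iff)

text \<open>By \<open>null\<close>, coefficients 1, 1 at the points 0, \<open>- a\<close> form a
  null vector of a positive semidefinite form. Such a vector is orthogonal to the unit mass at
  \<open>x\<close>, and the pairing of the two is \<open>Q x + Q (x + a)\<close>. In the proof,
  \<open>t\<close> scales the null vector, so the form is affine in \<open>t\<close>.\<close>

lemma positive_definite_antiperiodic:
  fixes Q :: "'a::ab_group_add \<Rightarrow> real"
  assumes pd: "positive_definite (\<lambda>x. complex_of_real (Q x))"
    and null: "Q 0 + Q a = 0"
  shows "Q (x + a) = - Q x"
proof (rule ccontr)
  assume ne: "Q (x + a) \<noteq> - Q x"
  define d where "d = Q (x + a) + Q x"
  have "d \<noteq> 0" using ne by (simp add: d_def)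
  have ge: "0 \<le> Q 0 + 2 * t * d" for t
  proof -
    let ?p = "\<lambda>i::nat. if i = 0 then 0 else if i = 1 then - a else x"
    let ?c = "\<lambda>i::nat. if i = 2 then 1 else t"
    have "0 \<le> (\<Sum>i<3. \<Sum>j<3. ?c i * ?c j * Q (?p i - ?p j))"
      by (rule positive_definite_of_real[OF pd])
    also have "\<dots> = 2 * t * t * (Q 0 + Q a) + Q 0 + 2 * t * d"
      using positive_definite_even[OF pd, of a] positive_definite_even[OF pd, of x]
        positive_definite_even[OF pd, of "x + a"]
      by (simp add: numeral_3_eq_3 d_def algebra_simps)
    finally show ?thesis by (simp add: null)
  qed
  \<comment> \<open>This value of \<open>t\<close> makes the affine expression in \<open>ge\<close>
    equal to -1.\<close>
  have "2 * ((- 1 - Q 0) / (2 * d)) * d = - 1 - Q 0" using \<open>d \<noteq> 0\<close> by simp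
  with ge[of "(- 1 - Q 0) / (2 * d)"] show False by linarith
qed

lemma not_sum_pos_posdef_V_pot: "\<not> sum_pos_posdef V_pot"
proof
  assume "sum_pos_posdef V_pot"
  then obtain P Q where P: "\<And>x. 0 \<le> P x" and pd: "positive_definite (\<lambda>x. complex_of_real (Q x))"
    and V: "\<And>x. V_pot x = P x + Q x"
    unfolding sum_pos_posdef_def by blast
  have le: "Q x \<le> V_pot x" for x using P[of x] V[of x] by simp
  have "0 \<le> (\<Sum>i<2. \<Sum>j<2. 1 * 1 * Q (int i - int j))"
    by (rule positive_definite_of_real[OF pd])
  then have "0 \<le> Q 0 + Q 1"
    using positive_definite_even[OF pd, of 1] by (simp add: numeral_2_eq_2)
  with le[of 0] le[of 1] have Q: "Q 0 + Q 1 = 0" "Q 0 = 1" by (auto simp: V_pot_def)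
  have "Q 4 = 1"
    using positive_definite_antiperiodic[OF pd Q(1), of 0] positive_definite_antiperiodic[OF pd Q(1), of 1]
      positive_definite_antiperiodic[OF pd Q(1), of 2] positive_definite_antiperiodic[OF pd Q(1), of 3] Q
    by simp
  with le[of 4] show False by (simp add: V_pot_def)
qed

text \<open>Both summands keep their property under restriction to a subgroup and under scaling by a
  nonnegative constant. The factor \<open>c\<close> serves to normalise the restriction of
  \<open>W_pot f\<close> to \<open>V_pot\<close>.\<close>

lemma sum_pos_posdef_restrict_int:
  fixes U :: "real \<Rightarrow> real"
  assumes "sum_pos_posdef U" "0 \<le> c"
  shows "sum_pos_posdef (\<lambda>n::int. c * U (of_int n))"
proof -
  obtain P Q where P: "\<And>x. 0 \<le> P x" and pd: "positive_definite (\<lambda>x. complex_of_real (Q x))"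
    and U: "\<And>x. U x = P x + Q x"
    using assms unfolding sum_pos_posdef_def by blast
  have "positive_definite (\<lambda>n::int. complex_of_real (c * Q (of_int n)))"
    unfolding positive_definite_def
  proof (intro allI)
    fix N and x :: "nat \<Rightarrow> int" and z :: "nat \<Rightarrow> complex"
    have "(\<Sum>i<N. \<Sum>j<N. z i * cnj (z j) * complex_of_real (Q (of_int (x i) - of_int (x j)))) \<in> \<real>\<^sub>\<ge>\<^sub>0"
      by (rule positive_definiteD[OF pd])
    then have "complex_of_real c * (\<Sum>i<N. \<Sum>j<N. z i * cnj (z j) * complex_of_real (Q (of_int (x i) - of_int (x j)))) \<in> \<real>\<^sub>\<ge>\<^sub>0"
      using assms(2) by (intro nonneg_Reals_mult_I) auto
    then show "(\<Sum>i<N. \<Sum>j<N. z i * cnj (z j) * complex_of_real (c * Q (of_int (x i - x j)))) \<in> \<real>\<^sub>\<ge>\<^sub>0"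
      by (simp add: sum_distrib_left mult_ac)
  qed
  then show ?thesis
    unfolding sum_pos_posdef_def using P assms(2)
    by (intro exI[of _ "\<lambda>n. c * P (of_int n)"] exI[of _ "\<lambda>n. c * Q (of_int n)"])
       (auto simp: U algebra_simps)
qed

section \<open>Stability of \<open>V_pot\<close> on the integers\<close>

lemma infsum_sum:
  fixes g :: "'i \<Rightarrow> 'a \<Rightarrow> real"
  assumes "finite I" "\<And>i. i \<in> I \<Longrightarrow> g i summable_on A"
  shows "infsum (\<lambda>x. \<Sum>i\<in>I. g i x) A = (\<Sum>i\<in>I. infsum (g i) A)"
    and "(\<lambda>x. \<Sum>i\<in>I. g i x) summable_on A"
proof -
  have "(\<lambda>x. \<Sum>i\<in>I. g i x) summable_on A \<and> infsum (\<lambda>x. \<Sum>i\<in>I. g i x) A = (\<Sum>i\<in>I. infsum (g i) A)"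
    using assms
  proof (induction I rule: finite_induct)
    case (insert i I)
    then show ?case
      by (simp add: infsum_add summable_on_add)
  qed simp
  then show "infsum (\<lambda>x. \<Sum>i\<in>I. g i x) A = (\<Sum>i\<in>I. infsum (g i) A)"
    "(\<lambda>x. \<Sum>i\<in>I. g i x) summable_on A" by auto
qed

lemma stable_int_V_pot: "stable_int V_pot"
  unfolding stable_int_def
proof (intro conjI allI impI; (elim conjE)?)
  show "bounded (range V_pot)"
    by (rule boundedI[of _ 1]) (auto simp: V_pot_def)
next
  fix \<rho> :: "int \<Rightarrow> real"
  assume nn: "\<forall>n. 0 \<le> \<rho> n" and sm: "\<rho> summable_on UNIV"
  have le: "\<rho> n \<le> infsum \<rho> UNIV" for n
    using finite_sum_le_infsum[OF sm, of "{n}"] nn by simp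
  have shift: "bij (\<lambda>m::int. m + k)" for k
    by (intro bijI' ) (auto intro: exI[of _ "y - k" for y])
  have shifted: "(\<lambda>m. \<rho> (m + k)) summable_on UNIV" for k
    using summable_on_reindex_bij_betw[OF shift[of k], of \<rho>] sm by simp
  \<comment> \<open>A nonnegative summable function is bounded by its total mass, so one factor can
    be replaced by a constant.\<close>
  have prod: "(\<lambda>m. \<rho> (m + i) * \<rho> (m + j)) summable_on UNIV" for i j
  proof (rule summable_on_comparison_test)
    show "(\<lambda>m. infsum \<rho> UNIV * \<rho> (m + j)) summable_on UNIV"
      by (intro summable_on_cmult_right shifted)
  qed (use nn le in \<open>auto intro: mult_right_mono\<close>)
  \<comment> \<open>Grouped by the difference \<open>k = m - n\<close>, the energy becomes the sum
    of \<open>V_pot k * c k\<close>. The summed product of two translates of \<open>\<rho>\<close>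
    depends only on their relative shift, which is what window sums require.\<close>
  define c where "c k = (\<Sum>\<^sub>\<infinity>m. \<rho> m * \<rho> (m - k))" for k
  have c: "(\<Sum>\<^sub>\<infinity>m. \<rho> (m + i) * \<rho> (m + j)) = c (i - j)" for i j
    using infsum_reindex_bij_betw[OF shift[of i], of "\<lambda>m. \<rho> m * \<rho> (m - (i - j))"]
    by (simp add: c_def algebra_simps)
  have "0 \<le> (\<Sum>n\<in>{-2..2}. V_pot n * c n)"
  proof (rule sum_nonneg_of_windows_nonneg)
    fix N
    \<comment> \<open>For each \<open>m\<close>, the translate of \<open>\<rho>\<close> by
      \<open>m\<close> supplies the weights on the window.\<close>
    have "0 \<le> (\<Sum>\<^sub>\<infinity>m. \<Sum>i<N. \<Sum>j<N. V_pot (int i - int j) * \<rho> (m + int i) * \<rho> (m + int j))"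
      by (intro infsum_nonneg V_pot_copositive_window) (use nn in auto)
    also have "\<dots> = (\<Sum>i<N. \<Sum>j<N. V_pot (int i - int j) * c (int i - int j))"
      by (simp add: mult.assoc infsum_sum prod summable_on_cmult_right infsum_cmult_right' c)
    finally show "0 \<le> (\<Sum>i<N. \<Sum>j<N. V_pot (int i - int j) * c (int i - int j))" .
  qed (simp add: V_pot_eq_0)
  also have "\<dots> = (\<Sum>\<^sub>\<infinity>m. \<Sum>k\<in>{-2..2}. V_pot k * (\<rho> m * \<rho> (m - k)))"
    unfolding c_def
    by (subst infsum_sum)
       (use prod[of 0 "- k" for k] in \<open>auto simp: infsum_cmult_right' intro!: summable_on_cmult_right\<close>)
  also have "\<dots> = (\<Sum>\<^sub>\<infinity>m. \<Sum>\<^sub>\<infinity>n. \<rho> m * V_pot (m - n) * \<rho> n)"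
  proof (rule infsum_cong)
    fix m
    have "(\<Sum>\<^sub>\<infinity>n. \<rho> m * V_pot (m - n) * \<rho> n) = (\<Sum>\<^sub>\<infinity>n\<in>{m-2..m+2}. \<rho> m * V_pot (m - n) * \<rho> n)"
      by (rule infsum_cong_neutral) (auto simp: V_pot_eq_0)
    also have "\<dots> = (\<Sum>n\<in>{m-2..m+2}. \<rho> m * V_pot (m - n) * \<rho> n)" by simp
    also have "\<dots> = (\<Sum>k\<in>{-2..2}. V_pot k * (\<rho> m * \<rho> (m - k)))"
      by (rule sum.reindex_bij_witness[of _ "\<lambda>k. m - k" "\<lambda>n. m - n"]) auto
    finally show "(\<Sum>k\<in>{-2..2}. V_pot k * (\<rho> m * \<rho> (m - k))) = (\<Sum>\<^sub>\<infinity>n. \<rho> m * V_pot (m - n) * \<rho> n)" ..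
  qed
  finally show "0 \<le> (\<Sum>\<^sub>\<infinity>m. \<Sum>\<^sub>\<infinity>n. \<rho> m * V_pot (m - n) * \<rho> n)" .
qed

section \<open>Lower semicontinuity of integrals, and the autocorrelation of a profile\<close>

text \<open>This is Fatou's lemma for real integrals, phrased as an eventual strict inequality so
  that it fits \<open>order_tendstoI\<close>.\<close>

lemma Fatou_eventually_less:
  fixes u :: "nat \<Rightarrow> 'a \<Rightarrow> real"
  assumes int: "\<And>n. integrable M (u n)" "integrable M v"
    and nn: "\<And>n x. 0 \<le> u n x"
    and lim: "AE x in M. (\<lambda>n. u n x) \<longlonglongrightarrow> v x"
    and less: "a < integral\<^sup>L M v"
  shows "\<forall>\<^sub>F n in sequentially. a < integral\<^sup>L M (u n)"
\<comment> \<open>Negative bounds are treated apart because \<open>ennreal\<close> sends them to 0;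
  for them nonnegativity of the integrals suffices.\<close>
proof (cases "0 \<le> a")
  case False
  then have "a < integral\<^sup>L M (u n)" for n
  proof -
    have "0 \<le> integral\<^sup>L M (u n)" by (intro Bochner_Integration.integral_nonneg nn)
    with False show ?thesis by linarith
  qed
  then show ?thesis by simp
next
  case True
  have v0: "AE x in M. 0 \<le> v x"
    using lim by eventually_elim (rule LIMSEQ_le_const, auto simp: nn)
  have "ennreal a < ennreal (integral\<^sup>L M v)"
    using True less by (simp add: ennreal_less_iff)
  also have "\<dots> = (\<integral>\<^sup>+x. ennreal (v x) \<partial>M)"
    using int(2) v0 by (simp add: nn_integral_eq_integral)
  also have "\<dots> = (\<integral>\<^sup>+x. liminf (\<lambda>n. ennreal (u n x)) \<partial>M)"
    by (rule nn_integral_cong_AE, use lim in eventually_elim)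
       (intro lim_imp_Liminf[symmetric] tendsto_ennrealI trivial_limit_sequentially)
  also have "\<dots> \<le> liminf (\<lambda>n. \<integral>\<^sup>+x. ennreal (u n x) \<partial>M)"
    using int(1) by (intro nn_integral_liminf) simp
  also have "\<dots> = liminf (\<lambda>n. ennreal (integral\<^sup>L M (u n)))"
    using int(1) nn by (simp add: nn_integral_eq_integral)
  finally have "\<forall>\<^sub>F n in sequentially. ennreal a < ennreal (integral\<^sup>L M (u n))"
    by (rule less_LiminfD)
  then show ?thesis
    using True by (simp add: ennreal_less_iff)
qed

text \<open>This is the convolution of \<open>f\<close> with its reflection. \<open>W_pot f\<close>
  is the combination of its integer translates with weights \<open>V_pot n\<close>.\<close>

definition autocorr :: "(real \<Rightarrow> real) \<Rightarrow> real \<Rightarrow> real" where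
  "autocorr f s = (LINT y|lborel. f (s + y) * f y)"

context
  fixes f :: "real \<Rightarrow> real"
  assumes f: "admissible_profile f"
begin

lemma profile_nonneg: "0 \<le> f x"
  using f by (simp add: admissible_profile_def)

lemma profile_eq_0: "1/2 \<le> \<bar>x\<bar> \<Longrightarrow> f x = 0"
proof -
  assume "1/2 \<le> \<bar>x\<bar>"
  then have "x \<notin> {-1/2<..<1/2}" by auto
  then show ?thesis using f unfolding admissible_profile_def by blast
qed

lemma profile_cont: "continuous_on {-1/2<..<1/2} f"
  using f by (simp add: admissible_profile_def)

lemma profile_borel [measurable]: "f \<in> borel_measurable borel"
proof -
  have "(\<lambda>x. indicator {-1/2<..<1/2} x *\<^sub>R f x) \<in> borel_measurable borel"
    by (intro borel_measurable_continuous_on_indicator profile_cont) simp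
  also have "(\<lambda>x. indicator {-1/2<..<1/2} x *\<^sub>R f x) = f"
  proof
    fix x show "indicator {-1/2<..<1/2} x *\<^sub>R f x = f x"
      using profile_eq_0[of x] by (cases "1/2 \<le> \<bar>x\<bar>") (auto simp: indicator_def abs_if split: if_splits)
  qed
  finally show ?thesis .
qed

lemma profile_sq_shift:
  shows integrable_profile_sq_shift: "integrable lborel (\<lambda>y. (f (s + y))\<^sup>2)"
    and integral_profile_sq_shift: "(LINT y|lborel. (f (s + y))\<^sup>2) = autocorr f 0"
proof -
  have "integrable lborel (\<lambda>y. (f y)\<^sup>2)"
    using f by (simp add: admissible_profile_def)
  from lborel_integrable_real_affine[OF this, of 1 s]
  show "integrable lborel (\<lambda>y. (f (s + y))\<^sup>2)" by simp
  show "(LINT y|lborel. (f (s + y))\<^sup>2) = autocorr f 0"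
    using lborel_integral_real_affine[of 1 "\<lambda>y. (f y)\<^sup>2" s]
    by (simp add: autocorr_def power2_eq_square)
qed

lemma integrable_profile_mult:
  "integrable lborel (\<lambda>y. f (s + y) * f (t + y))"
proof (rule Bochner_Integration.integrable_bound)
  show "integrable lborel (\<lambda>y. (f (s + y))\<^sup>2 + (f (t + y))\<^sup>2)"
    by (intro Bochner_Integration.integrable_add integrable_profile_sq_shift)
  have "\<bar>a * b\<bar> \<le> a\<^sup>2 + b\<^sup>2" for a b :: real
  proof -
    have "2 * (\<bar>a\<bar> * \<bar>b\<bar>) \<le> a\<^sup>2 + b\<^sup>2" "0 \<le> \<bar>a\<bar> * \<bar>b\<bar>"
      using sum_squares_bound[of "\<bar>a\<bar>" "\<bar>b\<bar>"] by simp_all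
    then show ?thesis unfolding abs_mult by linarith
  qed
  then show "AE y in lborel. norm (f (s + y) * f (t + y)) \<le> norm ((f (s + y))\<^sup>2 + (f (t + y))\<^sup>2)"
    by simp
qed measurable

lemma integral_profile_mult:
  "(LINT y|lborel. f (s + y) * f (t + y)) = autocorr f (s - t)"
  using lborel_integral_real_affine[of 1 "\<lambda>y. f (s - t + y) * f y" t]
  by (simp add: autocorr_def algebra_simps)

lemma autocorr_uminus: "autocorr f (- s) = autocorr f s"
  using integral_profile_mult[of 0 s] integral_profile_mult[of s 0] by (simp add: mult.commute)

lemma autocorr_nonneg: "0 \<le> autocorr f s"
  unfolding autocorr_def by (intro Bochner_Integration.integral_nonneg) (simp add: profile_nonneg)

text \<open>All translates of \<open>f\<close> have the same square integral, so only the cross term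
  varies. This yields both the maximum of \<open>autocorr f\<close> at 0 and one half of its
  continuity.\<close>

lemma integral_profile_diff_sq:
  "(LINT y|lborel. (f (s + y) - f (t + y))\<^sup>2) = 2 * autocorr f 0 - 2 * autocorr f (s - t)"
  and integrable_profile_diff_sq: "integrable lborel (\<lambda>y. (f (s + y) - f (t + y))\<^sup>2)"
proof -
  have *: "(f (s + y) - f (t + y))\<^sup>2 = (f (s + y))\<^sup>2 + (f (t + y))\<^sup>2 - 2 * (f (s + y) * f (t + y))" for y
    by (simp add: power2_diff)
  show "(LINT y|lborel. (f (s + y) - f (t + y))\<^sup>2) = 2 * autocorr f 0 - 2 * autocorr f (s - t)"
    unfolding *
    by (simp add: integrable_profile_sq_shift integrable_profile_mult integral_profile_sq_shift integral_profile_mult)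
  show "integrable lborel (\<lambda>y. (f (s + y) - f (t + y))\<^sup>2)"
    unfolding * by (intro Bochner_Integration.integrable_add Bochner_Integration.integrable_diff
        integrable_profile_sq_shift integrable_mult_right integrable_profile_mult)
qed

lemma autocorr_le: "autocorr f s \<le> autocorr f 0"
  using integral_profile_diff_sq[of s 0] Bochner_Integration.integral_nonneg[of lborel "\<lambda>y. (f (s + y) - f (0 + y))\<^sup>2"]
  by simp

text \<open>The support lies in an open interval of length 1, so a shift by at least 1 makes it
  disjoint from itself. The boundary case of a shift by exactly 1 is what separates neighbouring
  integers.\<close>

lemma autocorr_eq_0: "1 \<le> \<bar>s\<bar> \<Longrightarrow> autocorr f s = 0"
proof -
  assume s: "1 \<le> \<bar>s\<bar>"
  have "f (s + y) * f y = 0" for y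
  proof (cases "1/2 \<le> \<bar>y\<bar>")
    case False
    then have "1/2 \<le> \<bar>s + y\<bar>" using s by linarith
    then show ?thesis by (simp add: profile_eq_0)
  qed (simp add: profile_eq_0)
  then have "(\<lambda>y. f (s + y) * f y) = (\<lambda>_. 0)" by blast
  then show "autocorr f s = 0" by (simp only: autocorr_def) simp
qed

lemma isCont_profile: "\<bar>x\<bar> \<noteq> 1/2 \<Longrightarrow> isCont f x"
proof (cases "\<bar>x\<bar> < 1/2")
  case True
  then have "x \<in> {-1/2<..<1/2}" by (auto simp: abs_if split: if_splits)
  then show ?thesis
    using profile_cont continuous_on_eq_continuous_at[OF open_greaterThanLessThan] by blast
next
  case False
  assume "\<bar>x\<bar> \<noteq> 1/2"
  with False have "x \<in> - {-1/2..1/2}" by auto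
  then have "\<forall>\<^sub>F y in nhds x. y \<in> - {-1/2..1/2}"
    by (intro eventually_nhds_in_open) auto
  then have "\<forall>\<^sub>F y in nhds x. f y = 0"
    by eventually_elim (auto intro!: profile_eq_0)
  then show ?thesis
    by (subst isCont_cong[where g = "\<lambda>_. 0"]) auto
qed

text \<open>Since f may blow up at the endpoints, there is no dominating function. Fatou's lemma for the
  product bounds the limit from one side and, because all translates have the same square integral,
  Fatou's lemma for the squared difference bounds it from the other.\<close>

lemma isCont_autocorr: "isCont (autocorr f) s"
  unfolding continuous_at_sequentially comp_def
proof (intro allI impI)
  fix x assume x: "x \<longlonglongrightarrow> s"
  \<comment> \<open>Convergence can fail only where \<open>s + y\<close> is an endpoint of the
    interval, that is, for two values of \<open>y\<close>.\<close>
  have lim: "AE y in lborel. (\<lambda>n. f (x n + y)) \<longlonglongrightarrow> f (s + y)"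
    using AE_lborel_singleton[of "1/2 - s"] AE_lborel_singleton[of "-1/2 - s"]
  proof eventually_elim
    case (elim y)
    then have "\<bar>s + y\<bar> \<noteq> 1/2" by linarith
    then show ?case
      by (intro isCont_tendsto_compose[OF isCont_profile] tendsto_intros x)
  qed
  have int: "integrable lborel (\<lambda>y. f (t + y) * f y)" for t
    using integrable_profile_mult[of t 0] by simp
  have int2: "integrable lborel (\<lambda>y. (f (t + y) - f y)\<^sup>2)" for t
    using integrable_profile_diff_sq[of t 0] by simp
  have eq: "(LINT y|lborel. (f (t + y) - f y)\<^sup>2) = 2 * autocorr f 0 - 2 * autocorr f t" for t
    using integral_profile_diff_sq[of t 0] by simp
  show "(\<lambda>n. autocorr f (x n)) \<longlonglongrightarrow> autocorr f s"
  proof (rule order_tendstoI)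
    fix a assume less: "a < autocorr f s"
    show "\<forall>\<^sub>F n in sequentially. a < autocorr f (x n)"
      unfolding autocorr_def
    proof (rule Fatou_eventually_less[OF int int])
      show "AE y in lborel. (\<lambda>n. f (x n + y) * f y) \<longlonglongrightarrow> f (s + y) * f y"
        using lim by eventually_elim (intro tendsto_intros)
    qed (use less in \<open>simp_all add: profile_nonneg autocorr_def\<close>)
  next
    fix a assume "autocorr f s < a"
    then have less: "2 * autocorr f 0 - 2 * a < (LINT y|lborel. (f (s + y) - f y)\<^sup>2)"
      by (simp add: eq)
    have "\<forall>\<^sub>F n in sequentially. 2 * autocorr f 0 - 2 * a < (LINT y|lborel. (f (x n + y) - f y)\<^sup>2)"
    proof (rule Fatou_eventually_less[OF int2 int2, rotated 2])
      show "AE y in lborel. (\<lambda>n. (f (x n + y) - f y)\<^sup>2) \<longlonglongrightarrow> (f (s + y) - f y)\<^sup>2"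
        using lim by eventually_elim (intro tendsto_intros)
    qed (use less in simp_all)
    then show "\<forall>\<^sub>F n in sequentially. autocorr f (x n) < a"
      by (simp add: eq)
  qed
qed

text \<open>If the square integral were 0, \<open>f\<close> would vanish almost everywhere, whereas
  continuity keeps it nonzero on an interval next to any point where it is nonzero.\<close>

lemma autocorr_0_pos: "0 < autocorr f 0"
proof (rule ccontr)
  assume "\<not> 0 < autocorr f 0"
  then have "autocorr f 0 = 0" using autocorr_nonneg[of 0] by simp
  then have "AE y in lborel. (f y)\<^sup>2 = 0"
    using integral_profile_sq_shift[of 0] integrable_profile_sq_shift[of 0]
      integral_nonneg_eq_0_iff_AE[of lborel "\<lambda>y. (f y)\<^sup>2"] by simp
  then have ae: "AE y in lborel. f y = 0" by simp
  obtain x where x: "f x \<noteq> 0" using f by (auto simp: admissible_profile_def)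
  then have "\<bar>x\<bar> < 1/2" using profile_eq_0 by force
  then have "isCont f x" by (simp add: isCont_profile)
  then have "\<forall>\<^sub>F y in nhds x. f y \<noteq> 0"
    using x by (intro tendsto_imp_eventually_ne) (auto simp: isCont_def tendsto_at_iff_tendsto_nhds)
  then obtain e where e: "0 < e" "\<And>y. dist y x < e \<Longrightarrow> f y \<noteq> 0"
    unfolding eventually_nhds_metric by blast
  have "AE y in lborel. y \<notin> {x<..<x + e}"
    using ae by eventually_elim (use e in \<open>auto simp: dist_real_def\<close>)
  then have "{x<..<x + e} \<in> null_sets lborel"
    by (subst AE_iff_null_sets) simp_all
  then show False using e(1) by (simp add: null_sets_def)
qed

section \<open>The restriction of \<open>W_pot\<close> to the integers\<close>

lemma W_pot_eq: "W_pot f x = (\<Sum>n\<in>{-2..2}. V_pot n * autocorr f (of_int n - x))"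
proof -
  have "W_pot f x = (\<Sum>\<^sub>\<infinity>n. V_pot n * autocorr f (of_int n - x))"
    by (simp add: W_pot_def autocorr_def mult.assoc)
  also have "\<dots> = (\<Sum>\<^sub>\<infinity>n\<in>{-2..2}. V_pot n * autocorr f (of_int n - x))"
    by (rule infsum_cong_neutral) (auto simp: V_pot_def)
  finally show ?thesis by simp
qed

text \<open>Distinct integers are at distance at least 1, where the autocorrelation vanishes, so
  only the term \<open>n = k\<close> survives.\<close>

lemma W_pot_of_int: "W_pot f (of_int k) = autocorr f 0 * V_pot k"
proof -
  have "autocorr f (of_int n - of_int k) = (if n = k then autocorr f 0 else 0)" for n
    by (auto intro!: autocorr_eq_0 simp flip: of_int_diff)
  then have "W_pot f (of_int k) = (\<Sum>n\<in>{-2..2}. if n = k then autocorr f 0 * V_pot k else 0)"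
    unfolding W_pot_eq by (intro sum.cong refl) simp
  then show ?thesis
    using V_pot_eq_0[of k] by (simp only: sum.delta finite_atLeastAtMost_int) auto
qed

lemma not_sum_pos_posdef_W_pot: "\<not> sum_pos_posdef (W_pot f)"
proof
  assume "sum_pos_posdef (W_pot f)"
  then have "sum_pos_posdef (\<lambda>n::int. inverse (autocorr f 0) * W_pot f (of_int n))"
    by (rule sum_pos_posdef_restrict_int) (simp add: autocorr_nonneg)
  also have "(\<lambda>n. inverse (autocorr f 0) * W_pot f (of_int n)) = V_pot"
    using autocorr_0_pos by (simp add: W_pot_of_int fun_eq_iff field_simps)
  finally show False using not_sum_pos_posdef_V_pot by simp
qed

section \<open>Regularity and stability of \<open>W_pot\<close> on the reals\<close>

lemma autocorr_borel [measurable]: "autocorr f \<in> borel_measurable borel"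
  using isCont_autocorr
  by (intro borel_measurable_continuous_onI continuous_at_imp_continuous_on) auto

lemma norm_autocorr_le: "norm (autocorr f s) \<le> autocorr f 0"
  using autocorr_le[of s] autocorr_nonneg[of s] by simp

lemma W_pot_continuous: "continuous_on UNIV (W_pot f)"
proof -
  have "continuous_on UNIV (autocorr f)"
    using isCont_autocorr by (intro continuous_at_imp_continuous_on) auto
  then have "continuous_on UNIV (\<lambda>x. autocorr f (c - x))" for c
    by (rule continuous_on_compose2) (auto intro: continuous_intros)
  then show ?thesis
    unfolding W_pot_eq by (intro continuous_on_sum continuous_on_mult continuous_on_const)
qed

lemma W_pot_bounded: "bounded (range (W_pot f))"
proof (rule boundedI)
  fix w assume "w \<in> range (W_pot f)"
  then obtain x where w: "w = W_pot f x" by auto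
  have "norm w \<le> (\<Sum>n\<in>{-2..2}. norm (V_pot n * autocorr f (of_int n - x)))"
    unfolding w W_pot_eq by (rule norm_sum)
  also have "\<dots> \<le> (\<Sum>n\<in>{-2..2::int}. 1 * autocorr f 0)"
    unfolding norm_mult using norm_autocorr_le
    by (intro sum_mono mult_mono) (auto simp: V_pot_def)
  finally show "norm w \<le> (\<Sum>n\<in>{-2..2::int}. 1 * autocorr f 0)" .
qed

text \<open>For fixed \<open>t\<close>, the values of the smeared measure \<open>F\<close> along the
  lattice of points \<open>t + i\<close> are nonnegative weights to which copositivity of
  \<open>V_pot\<close> applies. Integrating over \<open>t\<close> turns products of these values
  into the correlations \<open>B\<close>.\<close>

lemma W_pot_energy_nonneg:
  assumes "finite_measure \<rho>" and sets: "sets \<rho> = sets borel"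
  shows "0 \<le> (LINT x|\<rho>. LINT y|\<rho>. W_pot f (x - y))"
proof -
  note sets [measurable_cong]
  interpret \<rho>: finite_measure \<rho> by fact
  interpret P: pair_sigma_finite \<rho> \<rho> ..
  define P where "P = \<rho> \<Otimes>\<^sub>M \<rho>"
  have sets_P [measurable_cong]: "sets P = sets (borel \<Otimes>\<^sub>M borel)"
    unfolding P_def by (intro sets_pair_measure_cong sets)
  interpret fP: finite_measure P
    unfolding P_def by (intro finite_measure_pair_measure assms)
  interpret PL: pair_sigma_finite P lborel ..
  define B where "B n = (LINT x|\<rho>. LINT y|\<rho>. autocorr f (of_int n - x + y))" for n :: int
  \<comment> \<open>Where \<open>f\<close> is unbounded this integral may diverge; its value is then
    0, which is still a nonnegative weight.\<close>
  define F where "F s = (LINT x|\<rho>. f (s - x))" for s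
  \<comment> \<open>\<open>G i j\<close> stands in for the product of \<open>F (t + i)\<close> and
    \<open>F (t + j)\<close>: as an integral over the product measure, its integrability in
    \<open>t\<close> comes from Fubini.\<close>
  define G where "G i j t = (LINT z|P. f (of_int i - fst z + t) * f (of_int j - snd z + t))"
    for i j :: int and t

  have A_int: "integrable \<rho> (\<lambda>y. autocorr f (c + y))" "integrable P (\<lambda>z. autocorr f (c - fst z + snd z))" for c
    by (rule \<rho>.integrable_const_bound fP.integrable_const_bound, rule AE_I2, rule norm_autocorr_le,
        measurable)+
  have B_int: "integrable \<rho> (\<lambda>x. LINT y|\<rho>. autocorr f (c - x + y))" for c
    using P.integrable_fst'[of "\<lambda>z. autocorr f (c - fst z + snd z)"] A_int(2) by (simp add: P_def)

  \<comment> \<open>Integrating over \<open>t\<close> first gives a value of the autocorrelation,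
    which is bounded and hence integrable for the finite measure \<open>P\<close>.\<close>
  have h_int: "integrable (P \<Otimes>\<^sub>M lborel) (\<lambda>(z, t). f (c - fst z + t) * f (d - snd z + t))" for c d
  proof (rule PL.Fubini_integrable)
    have "(LINT t|lborel. norm (f (c - fst z + t) * f (d - snd z + t))) = autocorr f ((c - d) - fst z + snd z)" for z
      using integral_profile_mult[of "c - fst z" "d - snd z"] profile_nonneg
      by (simp add: algebra_simps)
    then show "integrable P (\<lambda>z. LINT t|lborel. norm (case (z, t) of (z, t) \<Rightarrow> f (c - fst z + t) * f (d - snd z + t)))"
      using A_int(2) by simp
  qed (use integrable_profile_mult in auto)

  have G_int: "integrable lborel (G i j)" and B_eq: "B (i - j) = (LINT t|lborel. G i j t)" for i j
  proof -
    show "integrable lborel (G i j)"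
      unfolding G_def by (rule PL.integrable_snd[OF h_int])
    have "(LINT t|lborel. G i j t) = (LINT z|P. LINT t|lborel. f (of_int i - fst z + t) * f (of_int j - snd z + t))"
      unfolding G_def by (rule PL.Fubini_integral[OF h_int])
    also have "\<dots> = (LINT z|P. autocorr f (of_int (i - j) - fst z + snd z))"
      unfolding integral_profile_mult by (simp add: algebra_simps)
    also have "\<dots> = B (i - j)"
      using P.integral_fst'[of "\<lambda>z. autocorr f (of_int (i - j) - fst z + snd z)"] A_int(2)
      unfolding P_def B_def by simp
    finally show "B (i - j) = (LINT t|lborel. G i j t)" by simp
  qed

  \<comment> \<open>For almost every \<open>t\<close> the section is integrable over
    \<open>P\<close>, and then the double integral of a product of separate functions of
    \<open>x\<close> and \<open>y\<close> factors.\<close>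
  have G_eq: "AE t in lborel. G i j t = F (t + of_int i) * F (t + of_int j)" for i j
    using PL.AE_integrable_snd[OF h_int[of "of_int i" "of_int j"]]
  proof eventually_elim
    case (elim t)
    then have "G i j t = (LINT x|\<rho>. LINT y|\<rho>. f (of_int i - x + t) * f (of_int j - y + t))"
      unfolding G_def P_def
      using P.integral_fst'[of "\<lambda>z. f (of_int i - fst z + t) * f (of_int j - snd z + t)"] by simp
    also have "\<dots> = F (t + of_int i) * F (t + of_int j)"
      by (simp add: F_def algebra_simps)
    finally show ?case .
  qed

  have "0 \<le> (\<Sum>n\<in>{-2..2}. V_pot n * B n)"
  proof (rule sum_nonneg_of_windows_nonneg)
    fix N
    have "AE t in lborel. \<forall>i\<in>{..<N}. \<forall>j\<in>{..<N}.
        G (int i) (int j) t = F (t + of_int (int i)) * F (t + of_int (int j))"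
      by (intro AE_finite_allI finite_lessThan G_eq)
    then have "AE t in lborel. 0 \<le> (\<Sum>i<N. \<Sum>j<N. V_pot (int i - int j) * G (int i) (int j) t)"
    proof eventually_elim
      case (elim t)
      have "0 \<le> (\<Sum>i<N. \<Sum>j<N. V_pot (int i - int j) * F (t + of_int (int i)) * F (t + of_int (int j)))"
        by (rule V_pot_copositive_window[of "\<lambda>i. F (t + of_int i)"])
           (simp add: F_def Bochner_Integration.integral_nonneg profile_nonneg)
      also have "\<dots> = (\<Sum>i<N. \<Sum>j<N. V_pot (int i - int j) * G (int i) (int j) t)"
        using elim by (simp add: mult.assoc)
      finally show ?case .
    qed
    then have "0 \<le> (LINT t|lborel. (\<Sum>i<N. \<Sum>j<N. V_pot (int i - int j) * G (int i) (int j) t))"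
      by (rule integral_nonneg_AE)
    also have "\<dots> = (\<Sum>i<N. \<Sum>j<N. V_pot (int i - int j) * B (int i - int j))"
      using G_int by (simp add: B_eq)
    finally show "0 \<le> (\<Sum>i<N. \<Sum>j<N. V_pot (int i - int j) * B (int i - int j))" .
  qed (simp add: V_pot_eq_0)
  also have "\<dots> = (LINT x|\<rho>. (\<Sum>n\<in>{-2..2}. V_pot n * (LINT y|\<rho>. autocorr f (of_int n - x + y))))"
    unfolding B_def using B_int by simp
  also have "\<dots> = (LINT x|\<rho>. LINT y|\<rho>. W_pot f (x - y))"
  proof -
    have W: "W_pot f (x - y) = (\<Sum>n\<in>{-2..2}. V_pot n * autocorr f (of_int n - x + y))" for x y
      by (simp add: W_pot_eq algebra_simps)
    show ?thesis unfolding W using A_int(1) by simp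
  qed
  finally show ?thesis .
qed

lemma stable_real_W_pot: "stable_real (W_pot f)"
  unfolding stable_real_def
  by (intro conjI allI impI W_pot_continuous W_pot_bounded W_pot_energy_nonneg) auto

end

theorem mainTheorem1:
  shows "(stable_int V_pot \<and> \<not> sum_pos_posdef V_pot) \<and>
         (\<forall>f. admissible_profile f \<longrightarrow>
            stable_real (W_pot f) \<and> \<not> sum_pos_posdef (W_pot f))"
  using stable_int_V_pot not_sum_pos_posdef_V_pot stable_real_W_pot not_sum_pos_posdef_W_pot
  by blast

end
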